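(* For any commutative ring $R$, the maximal elements of $\operatorname{Hom}(R)$ are exactly the pairs $(P,R\setminus P)$, where $P$ is a prime ideal of $R$.
   Context: All rings are associative with identity $1\neq 0$ (not necessarily commutative) and ring morphisms send $1$ to $1$. $U(S)$ denotes the group of two-sided invertible elements of a ring $S$. For a ring $R$, $\operatorname{Hom}(R)$ denotes the set of all pairs $(\ker(\varphi),\varphi^{-1}(U(S)))$ where $\varphi\colon R\to S$ is a ring morphism into an arbitrary (possibly non-commutative) ring $S$, partially ordered by $(\mathfrak a,M)\le(\mathfrak b,N)$ if and only if $\mathfrak a\subseteq\mathfrak b$ and $M\subseteq N$. *)

theory Defs
  imports "HOL-Algebra.Algebra" "HOL-Library.Product_Order"
begin

text \<open>
  A pair \<open>(ker \<phi>, \<phi>\<^sup>-\<^sup>1(U(S)))\<close> for every ring morphism \<open>\<phi> : R \<rightarrow> S\<close> into a nonzero, possibly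
  noncommutative ring \<open>S\<close>. A definition cannot quantify over the carrier type of \<open>S\<close>, so the
  carrier is taken inside \<open>'a + nat\<close>. This loses nothing: replacing \<open>S\<close> by the subring generated by
  \<open>\<phi>(R)\<close> and the inverses of the units in \<open>\<phi>(R)\<close> changes neither component of the pair, and that
  subring has at most \<open>max |R| \<aleph>\<^sub>0\<close> elements. Lemma \<open>mem_HomI\<close> below proves that morphisms
  into rings over an arbitrary type contribute no further pairs.

  The order on pairs is componentwise inclusion, i.e.\ the instance of \<open>\<le>\<close> from \<open>Product_Order\<close>.
\<close>

definition Hom :: "('a, 'm) ring_scheme \<Rightarrow> ('a set \<times> 'a set) set" where
  "Hom R = {(a_kernel R S \<phi>, {x \<in> carrier R. \<phi> x \<in> Units S}) |
     (S :: ('a + nat) ring) \<phi>. ring S \<and> \<one>\<^bsub>S\<^esub> \<noteq> \<zero>\<^bsub>S\<^esub> \<and> \<phi> \<in> ring_hom R S}"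

lemma infinite_UNIV_sum_nat: "infinite (UNIV :: ('a + nat) set)"
  by (simp add: finite_Plus_UNIV_iff)

lemma generate_ring_lepoll:
  fixes S :: "('b, 'n) ring_scheme" and U :: "'c set"
  assumes inf: "infinite U" and G: "(card_of G, card_of U) \<in> ordLeq"
  shows "(card_of (generate_ring S G), card_of U) \<in> ordLeq"
proof -
  define step where "step A = A \<union> (\<lambda>x. \<ominus>\<^bsub>S\<^esub> x) ` A \<union>
      ((\<lambda>(x, y). x \<oplus>\<^bsub>S\<^esub> y) ` (A \<times> A) \<union> (\<lambda>(x, y). x \<otimes>\<^bsub>S\<^esub> y) ` (A \<times> A))" for A
  define L where "L n = (step ^^ n) (insert \<one>\<^bsub>S\<^esub> G)" for n :: nat
  let ?r = "card_of U"
  have r: "infinite (Field ?r)" "Card_order ?r"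
    using inf by (auto simp: card_of_Card_order)
  have Un: "(card_of (A \<union> B), ?r) \<in> ordLeq"
    if "(card_of A, ?r) \<in> ordLeq" "(card_of B, ?r) \<in> ordLeq" for A B :: "'b set"
    using card_of_Un_ordLeq_infinite_Field[OF r(1) _ _ r(2)] that by blast
  have img: "(card_of (f ` A), ?r) \<in> ordLeq"
    if "(card_of A, ?r) \<in> ordLeq" for f and A :: "'d set"
    using card_of_image that ordLeq_transitive by blast
  have Tim: "(card_of (A \<times> A), ?r) \<in> ordLeq" if "(card_of A, ?r) \<in> ordLeq" for A :: "'b set"
    using card_of_Times_ordLeq_infinite_Field[OF r(1) _ _ r(2)] that by blast
  have one: "(card_of {\<one>\<^bsub>S\<^esub>}, ?r) \<in> ordLeq"
    using inf by (metis card_of_singl_ordLeq finite.emptyI)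
  have L: "(card_of (L n), ?r) \<in> ordLeq" for n
  proof (induction n)
    case 0
    show ?case using Un[OF one G] by (simp add: L_def)
  next
    case (Suc n)
    have "L (Suc n) = step (L n)" by (simp add: L_def)
    then show ?case
      unfolding step_def using Suc by (auto intro!: Un img Tim)
  qed
  have nat: "(card_of (UNIV :: nat set), ?r) \<in> ordLeq"
    using inf infinite_iff_card_of_nat by blast
  have UnL: "(card_of (\<Union>n. L n), ?r) \<in> ordLeq"
    using card_of_UNION_ordLeq_infinite[OF inf nat] L by blast
  have SucL: "L (Suc n) = step (L n)" for n by (simp add: L_def)
  have step_inc: "A \<subseteq> step A" for A by (auto simp: step_def)
  have mono: "L m \<subseteq> L n" if "m \<le> n" for m n
    using that by (rule lift_Suc_mono_le[rotated]) (simp add: SucL step_inc)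
  have "generate_ring S G \<subseteq> (\<Union>n. L n)"
  proof
    fix x assume "x \<in> generate_ring S G"
    then show "x \<in> (\<Union>n. L n)"
    proof induction
      case one
      then show ?case by (auto simp: L_def intro!: exI[of _ 0])
    next
      case (incl h)
      then show ?case by (auto simp: L_def intro!: exI[of _ 0])
    next
      case (a_inv h)
      then obtain n where "h \<in> L n" by blast
      then have "\<ominus>\<^bsub>S\<^esub> h \<in> L (Suc n)" unfolding SucL step_def by blast
      then show ?case by blast
    next
      case (eng_add h1 h2)
      then obtain m n where "h1 \<in> L m" "h2 \<in> L n" by blast
      then have "h1 \<in> L (max m n)" "h2 \<in> L (max m n)"
        using mono[of m "max m n"] mono[of n "max m n"] by auto
      then have "h1 \<oplus>\<^bsub>S\<^esub> h2 \<in> L (Suc (max m n))" unfolding SucL step_def by force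
      then show ?case by blast
    next
      case (eng_mult h1 h2)
      then obtain m n where "h1 \<in> L m" "h2 \<in> L n" by blast
      then have "h1 \<in> L (max m n)" "h2 \<in> L (max m n)"
        using mono[of m "max m n"] mono[of n "max m n"] by auto
      then have "h1 \<otimes>\<^bsub>S\<^esub> h2 \<in> L (Suc (max m n))" unfolding SucL step_def by force
      then show ?case by blast
    qed
  qed
  then show ?thesis using UnL card_of_mono1 ordLeq_transitive by blast
qed

lemma mem_HomI:
  fixes R :: "('a, 'm) ring_scheme" and S :: "('b, 'n) ring_scheme"
  assumes R: "ring R" and S: "ring S" "\<one>\<^bsub>S\<^esub> \<noteq> \<zero>\<^bsub>S\<^esub>" and h: "\<phi> \<in> ring_hom R S"
  shows "(a_kernel R S \<phi>, {x \<in> carrier R. \<phi> x \<in> Units S}) \<in> Hom R"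
proof -
  interpret S: ring S by (rule S)
  define M where "M = {x \<in> carrier R. \<phi> x \<in> Units S}"
  define G where "G = \<phi> ` carrier R \<union> (\<lambda>x. inv\<^bsub>S\<^esub> (\<phi> x)) ` M"
  define T where "T = generate_ring S G"
  define S' where "S' = S \<lparr>carrier := T\<rparr>"
  let ?r = "card_of (UNIV :: ('a + nat) set)"
  have hc: "\<phi> x \<in> carrier S" if "x \<in> carrier R" for x
    using h that by (auto simp: ring_hom_def)
  have Gc: "G \<subseteq> carrier S"
    unfolding G_def M_def using hc by auto
  have T: "G \<subseteq> T" "T \<subseteq> carrier S"
    using S.generate_ring_incl[OF Gc] by (auto simp: T_def generate_ring.incl)
  interpret S': ring S'
    unfolding S'_def T_def by (rule S.generate_ring_is_ring[OF Gc])
  have Ur: "(card_of (UNIV :: 'a set), ?r) \<in> ordLeq"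
    by (rule iffD1[OF card_of_ordLeq], rule exI[of _ Inl]) simp
  have A: "(card_of (g ` Y), ?r) \<in> ordLeq" for Y :: "'a set" and g :: "'a \<Rightarrow> 'b"
    using ordLeq_transitive[OF card_of_image ordLeq_transitive[OF card_of_mono1[OF subset_UNIV] Ur]] .
  have r: "infinite (Field ?r)" "Card_order ?r"
    using infinite_UNIV_sum_nat by (auto simp: card_of_Card_order)
  have "(card_of G, ?r) \<in> ordLeq"
    unfolding G_def using card_of_Un_ordLeq_infinite_Field[OF r(1) _ _ r(2)] A by blast
  then have "(card_of T, ?r) \<in> ordLeq"
    unfolding T_def by (rule generate_ring_lepoll[OF infinite_UNIV_sum_nat])
  then obtain f :: "'b \<Rightarrow> 'a + nat" where f: "inj_on f T"
    using card_of_ordLeq by metis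
  define Q where "Q = image_ring f S'"
  have inj: "inj_on f (carrier S')" using f by (simp add: S'_def)
  have Q: "ring Q" unfolding Q_def by (rule S'.inj_imp_image_ring_is_ring[OF inj])
  interpret Q: ring Q by (rule Q)
  have iso: "f \<in> ring_iso S' Q" unfolding Q_def by (rule inj_imp_image_ring_iso[OF inj])
  have hT: "\<phi> x \<in> T" if "x \<in> carrier R" for x
    using that T(1) by (auto simp: G_def)
  have h': "\<phi> \<in> ring_hom R S'"
    using h hT by (auto simp: ring_hom_def S'_def)
  have fh: "f \<in> ring_hom S' Q" using iso by (simp add: ring_iso_def)
  have comp: "f \<circ> \<phi> \<in> ring_hom R Q"
    by (rule ring_hom_trans[OF h' fh])
  have carQ: "carrier Q = f ` T" by (simp add: Q_def image_ring_carrier S'_def)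
  have oneQ: "\<one>\<^bsub>Q\<^esub> = f \<one>\<^bsub>S\<^esub>" by (simp add: Q_def image_ring_one S'_def)
  have zeroQ: "\<zero>\<^bsub>Q\<^esub> = f \<zero>\<^bsub>S\<^esub>" by (simp add: Q_def image_ring_zero S'_def)
  have multQ: "f (x \<otimes>\<^bsub>S\<^esub> y) = f x \<otimes>\<^bsub>Q\<^esub> f y" if "x \<in> T" "y \<in> T" for x y
    using fh that by (auto simp: ring_hom_def S'_def)
  have multT: "x \<otimes>\<^bsub>S\<^esub> y \<in> T" if "x \<in> T" "y \<in> T" for x y
    using that by (simp add: T_def generate_ring.eng_mult)
  have zT: "\<zero>\<^bsub>S\<^esub> \<in> T" "\<one>\<^bsub>S\<^esub> \<in> T"
    using S.zero_in_generate by (auto simp: T_def generate_ring.one)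
  have feq: "f x = f y \<longleftrightarrow> x = y" if "x \<in> T" "y \<in> T" for x y
    using inj_on_eq_iff[OF f that] .
  have nz: "\<one>\<^bsub>Q\<^esub> \<noteq> \<zero>\<^bsub>Q\<^esub>" using S(2) feq zT by (simp add: oneQ zeroQ)
  have ker: "a_kernel R Q (f \<circ> \<phi>) = a_kernel R S \<phi>"
    using hT zT feq by (auto simp: a_kernel_def' zeroQ)
  have units: "(f \<circ> \<phi>) x \<in> Units Q \<longleftrightarrow> \<phi> x \<in> Units S" if x: "x \<in> carrier R" for x
  proof
    assume u: "\<phi> x \<in> Units S"
    then have "inv\<^bsub>S\<^esub> (\<phi> x) \<in> T" using x T(1) by (auto simp: G_def M_def)
    moreover have "inv\<^bsub>S\<^esub> (\<phi> x) \<otimes>\<^bsub>S\<^esub> \<phi> x = \<one>\<^bsub>S\<^esub>" "\<phi> x \<otimes>\<^bsub>S\<^esub> inv\<^bsub>S\<^esub> (\<phi> x) = \<one>\<^bsub>S\<^esub>"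
      using u by auto
    ultimately have "f (inv\<^bsub>S\<^esub> (\<phi> x)) \<otimes>\<^bsub>Q\<^esub> f (\<phi> x) = \<one>\<^bsub>Q\<^esub>"
      "f (\<phi> x) \<otimes>\<^bsub>Q\<^esub> f (inv\<^bsub>S\<^esub> (\<phi> x)) = \<one>\<^bsub>Q\<^esub>" "f (inv\<^bsub>S\<^esub> (\<phi> x)) \<in> carrier Q"
      using hT[OF x] by (simp_all add: multQ[symmetric] oneQ carQ)
    then show "(f \<circ> \<phi>) x \<in> Units Q"
      using hT[OF x] by (auto simp: Units_def carQ)
  next
    assume "(f \<circ> \<phi>) x \<in> Units Q"
    then obtain y where y: "y \<in> T" "f y \<otimes>\<^bsub>Q\<^esub> f (\<phi> x) = \<one>\<^bsub>Q\<^esub>" "f (\<phi> x) \<otimes>\<^bsub>Q\<^esub> f y = \<one>\<^bsub>Q\<^esub>"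
      by (auto simp: Units_def carQ)
    then have "y \<otimes>\<^bsub>S\<^esub> \<phi> x = \<one>\<^bsub>S\<^esub>" "\<phi> x \<otimes>\<^bsub>S\<^esub> y = \<one>\<^bsub>S\<^esub>"
      using hT[OF x] zT multT feq by (auto simp: multQ[symmetric] oneQ)
    then show "\<phi> x \<in> Units S"
      using y(1) T(2) hc[OF x] by (auto simp: Units_def)
  qed
  have "{x \<in> carrier R. (f \<circ> \<phi>) x \<in> Units Q} = {x \<in> carrier R. \<phi> x \<in> Units S}"
    using units by blast
  then show ?thesis
    unfolding Hom_def using Q nz comp ker by blast
qed

end

theory Submission
  imports Defs
begin

text \<open>
  Every prime \<open>P\<close> gives the pair \<open>(P, R \ P)\<close>, as seen from the morphism of \<open>R\<close> into the field of
  fractions of \<open>R/P\<close> (lemma \<open>primeideal_pair_in_Hom\<close>).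

  The rest rests on one observation, which survives for a noncommutative codomain \<open>S \<noteq> 0\<close>: in a pair
  \<open>(a, M)\<close> of \<open>Hom R\<close> the set \<open>M\<close> is a submonoid of \<open>R\<close> that does not meet the ideal \<open>a\<close>, because
  \<open>0\<close> is not a unit of \<open>S\<close> (lemma \<open>HomE\<close>). This has two consequences.

  \<^item> An ideal containing \<open>a\<close> and maximal among those that avoid \<open>M\<close> is prime
    (lemma \<open>exists_primeideal_avoiding\<close>). So every pair lies below some \<open>(P, R \ P)\<close>, and a maximal
    pair has to be of this form.

  \<^item> If \<open>(P, R \ P) \<le> (b, N)\<close>, then disjointness of \<open>b\<close> and \<open>N\<close> forces \<open>b \<subseteq> R \ N \<subseteq> P\<close> and
    \<open>N \<subseteq> R \ b \<subseteq> R \ P\<close>. So the pairs \<open>(P, R \ P)\<close> are all maximal.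
\<close>

section \<open>Prime ideals avoiding a submonoid\<close>

text \<open>
  If \<open>x, y \<notin> P\<close>, then by maximality \<open>P + xR\<close> and \<open>P + yR\<close> both meet \<open>M\<close>. The product of an element
  of the first and one of the second lies in \<open>P + xyR\<close>. As \<open>M\<close> is closed under products, \<open>P + xyR\<close>
  meets \<open>M\<close> as well, whereas \<open>P\<close> does not; so \<open>xy \<notin> P\<close>.
\<close>

lemma (in cring) maximal_avoiding_ideal_is_prime:
  assumes P: "ideal P R" and disj: "P \<inter> M = {}"
    and M: "M \<subseteq> carrier R" "\<one> \<in> M" "\<And>x y. x \<in> M \<Longrightarrow> y \<in> M \<Longrightarrow> x \<otimes> y \<in> M"
    and max: "\<And>J. ideal J R \<Longrightarrow> P \<subseteq> J \<Longrightarrow> J \<inter> M = {} \<Longrightarrow> J = P"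
  shows "primeideal P R"
proof (rule primeidealI[OF P cring_axioms])
  interpret P: ideal P R by (rule P)
  show "carrier R \<noteq> P" using disj M(1,2) by auto
  have meets: "\<exists>p \<in> P. \<exists>r \<in> carrier R. p \<oplus> r \<otimes> x \<in> M" if x: "x \<in> carrier R" "x \<notin> P" for x
  proof -
    let ?J = "P <+>\<^bsub>R\<^esub> PIdl x"
    have sub: "P \<subseteq> ?J"
    proof
      fix p assume "p \<in> P"
      moreover have "p = p \<oplus> \<zero> \<otimes> x" using \<open>p \<in> P\<close> x by simp
      ultimately show "p \<in> ?J" unfolding set_add_def' cgenideal_def by blast
    qed
    have "x = \<zero> \<oplus> \<one> \<otimes> x" using x by simp
    then have "x \<in> ?J" unfolding set_add_def' cgenideal_def using P.zero_closed by blast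
    then have "?J \<noteq> P" using x(2) by blast
    then have "?J \<inter> M \<noteq> {}"
      using max[OF add_ideals[OF P cgenideal_ideal[OF x(1)]] sub] by blast
    then show ?thesis by (auto simp: set_add_def' cgenideal_def)
  qed
  fix x y assume x: "x \<in> carrier R" and y: "y \<in> carrier R" and xy: "x \<otimes> y \<in> P"
  show "x \<in> P \<or> y \<in> P"
  proof (rule ccontr)
    assume "\<not> (x \<in> P \<or> y \<in> P)"
    then obtain p r q s where
      p: "p \<in> P" "r \<in> carrier R" "p \<oplus> r \<otimes> x \<in> M" and q: "q \<in> P" "s \<in> carrier R" "q \<oplus> s \<otimes> y \<in> M"
      using meets x y by meson
    have c: "p \<in> carrier R" "q \<in> carrier R" using p q by auto
    have "(p \<oplus> r \<otimes> x) \<otimes> (q \<oplus> s \<otimes> y) =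
        p \<otimes> (q \<oplus> s \<otimes> y) \<oplus> (r \<otimes> x \<otimes> q \<oplus> (r \<otimes> s) \<otimes> (x \<otimes> y))"
      using x y p(2) q(2) c by algebra
    also have "\<dots> \<in> P"
    proof (intro P.a_closed)
      show "p \<otimes> (q \<oplus> s \<otimes> y) \<in> P" using p(1) q(2) c y by (simp add: P.I_r_closed)
      show "r \<otimes> x \<otimes> q \<in> P" using q(1) p(2) x by (simp add: P.I_l_closed)
      show "r \<otimes> s \<otimes> (x \<otimes> y) \<in> P" using xy p(2) q(2) by (simp add: P.I_l_closed)
    qed
    finally show False using M(3)[OF p(3) q(3)] disj by blast
  qed
qed

lemma (in cring) exists_primeideal_avoiding:
  assumes I: "ideal I R" and disj: "I \<inter> M = {}"
    and M: "M \<subseteq> carrier R" "\<one> \<in> M" "\<And>x y. x \<in> M \<Longrightarrow> y \<in> M \<Longrightarrow> x \<otimes> y \<in> M"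
  obtains P where "primeideal P R" "I \<subseteq> P" "P \<inter> M = {}"
proof -
  let ?A = "{J. ideal J R \<and> I \<subseteq> J \<and> J \<inter> M = {}}"
  have "\<exists>P \<in> ?A. \<forall>J \<in> ?A. P \<subseteq> J \<longrightarrow> J = P"
  proof (rule subset_Zorn_nonempty)
    show "?A \<noteq> {}" using I disj by auto
    fix C assume C: "C \<noteq> {}" "subset.chain ?A C"
    then have "subset.chain {J. ideal J R} C" by (auto simp: pred_on.chain_def)
    then have "ideal (\<Union>C) R" using chain_Union_is_ideal[of C] C(1) by simp
    then show "\<Union>C \<in> ?A" using C by (fastforce simp: pred_on.chain_def)
  qed
  then obtain P where P: "ideal P R" "I \<subseteq> P" "P \<inter> M = {}"
    and max: "\<And>J. ideal J R \<Longrightarrow> I \<subseteq> J \<Longrightarrow> J \<inter> M = {} \<Longrightarrow> P \<subseteq> J \<Longrightarrow> J = P" by auto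
  have "primeideal P R"
    using maximal_avoiding_ideal_is_prime[OF P(1,3) M] max P(2) by blast
  then show thesis using P that by blast
qed

section \<open>The field of fractions of a domain\<close>

text \<open>
  Over a domain and for \<open>b \<noteq> 0\<close> this is the equivalence class of \<open>(a, b)\<close> under equality of
  cross products, that is, all ways of writing \<open>a/b\<close> as \<open>x/y\<close>.
\<close>

definition fraction :: "('a, 'm) ring_scheme \<Rightarrow> 'a \<Rightarrow> 'a \<Rightarrow> ('a \<times> 'a) set" where
  "fraction R a b =
    {(x, y). x \<in> carrier R \<and> y \<in> carrier R \<and> y \<noteq> \<zero>\<^bsub>R\<^esub> \<and> x \<otimes>\<^bsub>R\<^esub> b = a \<otimes>\<^bsub>R\<^esub> y}"

text \<open>
  The operations take the union of the results over all representatives. All these results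
  coincide when \<open>R\<close> is a domain, so the union is a single fraction; this form spares a choice of
  representatives.
\<close>

definition fraction_ring :: "('a, 'm) ring_scheme \<Rightarrow> ('a \<times> 'a) set ring" where
  "fraction_ring R = \<lparr>
     carrier = {fraction R a b | a b. a \<in> carrier R \<and> b \<in> carrier R \<and> b \<noteq> \<zero>\<^bsub>R\<^esub>},
     monoid.mult = (\<lambda>p q. \<Union>(a, b) \<in> p. \<Union>(c, d) \<in> q. fraction R (a \<otimes>\<^bsub>R\<^esub> c) (b \<otimes>\<^bsub>R\<^esub> d)),
     one = fraction R \<one>\<^bsub>R\<^esub> \<one>\<^bsub>R\<^esub>,
     ring.zero = fraction R \<zero>\<^bsub>R\<^esub> \<one>\<^bsub>R\<^esub>,
     add = (\<lambda>p q. \<Union>(a, b) \<in> p. \<Union>(c, d) \<in> q.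
              fraction R (a \<otimes>\<^bsub>R\<^esub> d \<oplus>\<^bsub>R\<^esub> c \<otimes>\<^bsub>R\<^esub> b) (b \<otimes>\<^bsub>R\<^esub> d))\<rparr>"

text \<open>
  Reduces the evaluation of such a union to the usual well-definedness claim, that the result
  does not depend on the representatives.
\<close>

lemma UN_pairs_constant:
  assumes "(a, b) \<in> p" "(c, d) \<in> q"
    and "\<And>x y u v. (x, y) \<in> p \<Longrightarrow> (u, v) \<in> q \<Longrightarrow> F x y u v = A"
  shows "(\<Union>(x, y) \<in> p. \<Union>(u, v) \<in> q. F x y u v) = A"
proof -
  have const: "(\<Union>(u, v) \<in> q. F x y u v) = A" if "(x, y) \<in> p" for x y
    by (rule SUP_eq_const) (use assms(2) assms(3)[OF that] in auto)
  show ?thesis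
  proof (rule SUP_eq_const)
    show "p \<noteq> {}" using assms(1) by auto
    fix z assume "z \<in> p"
    then show "(case z of (x, y) \<Rightarrow> \<Union>(u, v) \<in> q. F x y u v) = A"
      by (cases z) (simp add: const)
  qed
qed

lemma fraction_ring_mult:
    "p \<otimes>\<^bsub>fraction_ring R\<^esub> q =
      (\<Union>(a, b) \<in> p. \<Union>(c, d) \<in> q. fraction R (a \<otimes>\<^bsub>R\<^esub> c) (b \<otimes>\<^bsub>R\<^esub> d))"
  and fraction_ring_add:
    "p \<oplus>\<^bsub>fraction_ring R\<^esub> q =
      (\<Union>(a, b) \<in> p. \<Union>(c, d) \<in> q. fraction R (a \<otimes>\<^bsub>R\<^esub> d \<oplus>\<^bsub>R\<^esub> c \<otimes>\<^bsub>R\<^esub> b) (b \<otimes>\<^bsub>R\<^esub> d))"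
  by (simp_all only: fraction_ring_def ring.select_convs monoid.select_convs)

context domain
begin

lemma mem_fraction_self:
  assumes "a \<in> carrier R" "b \<in> carrier R" "b \<noteq> \<zero>"
  shows "(a, b) \<in> fraction R a b"
  using assms by (simp add: fraction_def)

text \<open>
  The transitivity of the equality of cross products. It needs a domain, because the common factor
  \<open>b\<close> has to be cancelled.
\<close>

lemma fraction_subset:
  assumes "a \<in> carrier R" "b \<in> carrier R" "b \<noteq> \<zero>" "c \<in> carrier R" "d \<in> carrier R" "d \<noteq> \<zero>"
    and eq: "a \<otimes> d = c \<otimes> b"
  shows "fraction R a b \<subseteq> fraction R c d"
proof
  fix z assume "z \<in> fraction R a b"
  then obtain x y where z: "z = (x, y)"
    and xy: "x \<in> carrier R" "y \<in> carrier R" "y \<noteq> \<zero>" "x \<otimes> b = a \<otimes> y"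
    by (auto simp: fraction_def)
  have "b \<otimes> (x \<otimes> d) = (x \<otimes> b) \<otimes> d" using assms(1-6) xy(1,2) by algebra
  also have "\<dots> = (a \<otimes> d) \<otimes> y" unfolding xy(4) using assms(1-6) xy(1,2) by algebra
  also have "\<dots> = b \<otimes> (c \<otimes> y)" unfolding eq using assms(1-6) xy(1,2) by algebra
  finally have "x \<otimes> d = c \<otimes> y"
    using m_lcancel[OF assms(3,2), of "x \<otimes> d" "c \<otimes> y"] assms(4,5) xy(1,2) by blast
  then show "z \<in> fraction R c d" using z xy by (simp add: fraction_def)
qed

lemma fraction_eq_iff:
  assumes "a \<in> carrier R" "b \<in> carrier R" "b \<noteq> \<zero>" "c \<in> carrier R" "d \<in> carrier R" "d \<noteq> \<zero>"
  shows "fraction R a b = fraction R c d \<longleftrightarrow> a \<otimes> d = c \<otimes> b"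
proof
  assume "fraction R a b = fraction R c d"
  then show "a \<otimes> d = c \<otimes> b"
    using mem_fraction_self[OF assms(1-3)] by (simp add: fraction_def)
next
  assume "a \<otimes> d = c \<otimes> b"
  then show "fraction R a b = fraction R c d"
    using fraction_subset[OF assms] fraction_subset[OF assms(4-6) assms(1-3)] by auto
qed

lemma fraction_mult:
  assumes ab: "a \<in> carrier R" "b \<in> carrier R" "b \<noteq> \<zero>"
    and cd: "c \<in> carrier R" "d \<in> carrier R" "d \<noteq> \<zero>"
  shows "fraction R a b \<otimes>\<^bsub>fraction_ring R\<^esub> fraction R c d = fraction R (a \<otimes> c) (b \<otimes> d)"
proof -
  have eq: "fraction R (x \<otimes> u) (y \<otimes> v) = fraction R (a \<otimes> c) (b \<otimes> d)"
    if xy: "(x, y) \<in> fraction R a b" and uv: "(u, v) \<in> fraction R c d" for x y u v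
  proof -
    have x: "x \<in> carrier R" "y \<in> carrier R" "y \<noteq> \<zero>" "x \<otimes> b = a \<otimes> y"
      and u: "u \<in> carrier R" "v \<in> carrier R" "v \<noteq> \<zero>" "u \<otimes> d = c \<otimes> v"
      using xy uv by (auto simp: fraction_def)
    have "(x \<otimes> u) \<otimes> (b \<otimes> d) = (x \<otimes> b) \<otimes> (u \<otimes> d)" using x(1-3) u(1-3) ab cd by algebra
    also have "\<dots> = (a \<otimes> c) \<otimes> (y \<otimes> v)" unfolding x(4) u(4) using x(1-3) u(1-3) ab cd by algebra
    finally have "(x \<otimes> u) \<otimes> (b \<otimes> d) = (a \<otimes> c) \<otimes> (y \<otimes> v)" .
    then show ?thesis
      using x(1-3) u(1-3) ab cd by (intro fraction_eq_iff[THEN iffD2]) (simp_all add: integral_iff)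
  qed
  show ?thesis
    unfolding fraction_ring_mult
    by (rule UN_pairs_constant[OF mem_fraction_self[OF ab] mem_fraction_self[OF cd]]) (rule eq)
qed

lemma fraction_add:
  assumes ab: "a \<in> carrier R" "b \<in> carrier R" "b \<noteq> \<zero>"
    and cd: "c \<in> carrier R" "d \<in> carrier R" "d \<noteq> \<zero>"
  shows "fraction R a b \<oplus>\<^bsub>fraction_ring R\<^esub> fraction R c d
    = fraction R (a \<otimes> d \<oplus> c \<otimes> b) (b \<otimes> d)"
proof -
  have eq: "fraction R (x \<otimes> v \<oplus> u \<otimes> y) (y \<otimes> v) = fraction R (a \<otimes> d \<oplus> c \<otimes> b) (b \<otimes> d)"
    if xy: "(x, y) \<in> fraction R a b" and uv: "(u, v) \<in> fraction R c d" for x y u v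
  proof -
    have x: "x \<in> carrier R" "y \<in> carrier R" "y \<noteq> \<zero>" "x \<otimes> b = a \<otimes> y"
      and u: "u \<in> carrier R" "v \<in> carrier R" "v \<noteq> \<zero>" "u \<otimes> d = c \<otimes> v"
      using xy uv by (auto simp: fraction_def)
    have "(x \<otimes> v \<oplus> u \<otimes> y) \<otimes> (b \<otimes> d) = (x \<otimes> b) \<otimes> (v \<otimes> d) \<oplus> (u \<otimes> d) \<otimes> (y \<otimes> b)"
      using x(1-3) u(1-3) ab cd by algebra
    also have "\<dots> = (a \<otimes> d \<oplus> c \<otimes> b) \<otimes> (y \<otimes> v)"
      unfolding x(4) u(4) using x(1-3) u(1-3) ab cd by algebra
    finally have "(x \<otimes> v \<oplus> u \<otimes> y) \<otimes> (b \<otimes> d) = (a \<otimes> d \<oplus> c \<otimes> b) \<otimes> (y \<otimes> v)" .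
    then show ?thesis
      using x(1-3) u(1-3) ab cd by (intro fraction_eq_iff[THEN iffD2]) (simp_all add: integral_iff)
  qed
  show ?thesis
    unfolding fraction_ring_add
    by (rule UN_pairs_constant[OF mem_fraction_self[OF ab] mem_fraction_self[OF cd]]) (rule eq)
qed

lemma fraction_ring_carrierE:
  assumes "p \<in> carrier (fraction_ring R)"
  obtains a b where "p = fraction R a b" "a \<in> carrier R" "b \<in> carrier R" "b \<noteq> \<zero>"
  using assms by (auto simp: fraction_ring_def)

lemma fraction_closed:
  assumes "a \<in> carrier R" "b \<in> carrier R" "b \<noteq> \<zero>"
  shows "fraction R a b \<in> carrier (fraction_ring R)"
  using assms by (auto simp: fraction_ring_def)

lemma fraction_ring_zero: "\<zero>\<^bsub>fraction_ring R\<^esub> = fraction R \<zero> \<one>"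
  and fraction_ring_one: "\<one>\<^bsub>fraction_ring R\<^esub> = fraction R \<one> \<one>"
  by (simp_all add: fraction_ring_def)

lemmas fraction_ring_simps =
  fraction_mult fraction_add fraction_ring_zero fraction_ring_one fraction_closed
  fraction_eq_iff integral_iff

lemma fraction_ring_is_cring: "cring (fraction_ring R)"
proof (intro cringI abelian_groupI comm_monoidI)
  let ?K = "fraction_ring R"
  fix p q assume p': "p \<in> carrier ?K" and q': "q \<in> carrier ?K"
  obtain a b where p: "p = fraction R a b" "a \<in> carrier R" "b \<in> carrier R" "b \<noteq> \<zero>"
    using p' by (elim fraction_ring_carrierE)
  obtain c d where q: "q = fraction R c d" "c \<in> carrier R" "d \<in> carrier R" "d \<noteq> \<zero>"
    using q' by (elim fraction_ring_carrierE)
  show "p \<oplus>\<^bsub>?K\<^esub> q \<in> carrier ?K" "p \<otimes>\<^bsub>?K\<^esub> q \<in> carrier ?K"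
    using p q by (auto simp: fraction_ring_simps)
  show "p \<oplus>\<^bsub>?K\<^esub> q = q \<oplus>\<^bsub>?K\<^esub> p" "p \<otimes>\<^bsub>?K\<^esub> q = q \<otimes>\<^bsub>?K\<^esub> p"
    using p q by (simp_all add: fraction_ring_simps m_comm a_comm)
next
  let ?K = "fraction_ring R"
  fix p q r assume p': "p \<in> carrier ?K" and q': "q \<in> carrier ?K" and r': "r \<in> carrier ?K"
  obtain a b where p: "p = fraction R a b" "a \<in> carrier R" "b \<in> carrier R" "b \<noteq> \<zero>"
    using p' by (elim fraction_ring_carrierE)
  obtain c d where q: "q = fraction R c d" "c \<in> carrier R" "d \<in> carrier R" "d \<noteq> \<zero>"
    using q' by (elim fraction_ring_carrierE)
  obtain e f where r: "r = fraction R e f" "e \<in> carrier R" "f \<in> carrier R" "f \<noteq> \<zero>"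
    using r' by (elim fraction_ring_carrierE)
  show "(p \<oplus>\<^bsub>?K\<^esub> q) \<oplus>\<^bsub>?K\<^esub> r = p \<oplus>\<^bsub>?K\<^esub> (q \<oplus>\<^bsub>?K\<^esub> r)"
    using p q r by (simp add: fraction_ring_simps) algebra
  show "(p \<otimes>\<^bsub>?K\<^esub> q) \<otimes>\<^bsub>?K\<^esub> r = p \<otimes>\<^bsub>?K\<^esub> (q \<otimes>\<^bsub>?K\<^esub> r)"
    using p q r by (simp add: fraction_ring_simps m_assoc)
  show "(p \<oplus>\<^bsub>?K\<^esub> q) \<otimes>\<^bsub>?K\<^esub> r = p \<otimes>\<^bsub>?K\<^esub> r \<oplus>\<^bsub>?K\<^esub> q \<otimes>\<^bsub>?K\<^esub> r"
    using p q r by (simp add: fraction_ring_simps) algebra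
next
  let ?K = "fraction_ring R"
  show "\<zero>\<^bsub>?K\<^esub> \<in> carrier ?K" "\<one>\<^bsub>?K\<^esub> \<in> carrier ?K"
    by (simp_all add: fraction_ring_simps)
  fix p assume "p \<in> carrier ?K"
  then obtain a b where p: "p = fraction R a b" "a \<in> carrier R" "b \<in> carrier R" "b \<noteq> \<zero>"
    by (elim fraction_ring_carrierE)
  show "\<zero>\<^bsub>?K\<^esub> \<oplus>\<^bsub>?K\<^esub> p = p" "\<one>\<^bsub>?K\<^esub> \<otimes>\<^bsub>?K\<^esub> p = p"
    using p by (simp_all add: fraction_ring_simps)
  have "fraction R (\<ominus> a) b \<oplus>\<^bsub>?K\<^esub> p = \<zero>\<^bsub>?K\<^esub>"
    using p by (simp add: fraction_ring_simps) algebra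
  then show "\<exists>q \<in> carrier ?K. q \<oplus>\<^bsub>?K\<^esub> p = \<zero>\<^bsub>?K\<^esub>"
    using p fraction_closed[of "\<ominus> a" b] by auto
qed

lemma one_neq_zero_fraction_ring: "\<one>\<^bsub>fraction_ring R\<^esub> \<noteq> \<zero>\<^bsub>fraction_ring R\<^esub>"
  by (simp add: fraction_ring_simps)

lemma fraction_one_hom: "(\<lambda>a. fraction R a \<one>) \<in> ring_hom R (fraction_ring R)"
  by (rule ring_hom_memI) (simp_all add: fraction_ring_simps)

lemma fraction_one_eq_zero_iff:
  "a \<in> carrier R \<Longrightarrow> fraction R a \<one> = \<zero>\<^bsub>fraction_ring R\<^esub> \<longleftrightarrow> a = \<zero>"
  by (simp add: fraction_ring_simps)

lemma fraction_one_in_Units: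
  assumes "a \<in> carrier R" "a \<noteq> \<zero>"
  shows "fraction R a \<one> \<in> Units (fraction_ring R)"
proof -
  have "fraction R \<one> a \<otimes>\<^bsub>fraction_ring R\<^esub> fraction R a \<one> = \<one>\<^bsub>fraction_ring R\<^esub>"
    "fraction R a \<one> \<otimes>\<^bsub>fraction_ring R\<^esub> fraction R \<one> a = \<one>\<^bsub>fraction_ring R\<^esub>"
    using assms by (simp_all add: fraction_ring_simps)
  then show ?thesis
    using assms fraction_closed[of a \<one>] fraction_closed[of \<one> a] by (auto simp: Units_def)
qed

end

section \<open>Pairs of kernels and preimages of units\<close>

lemma (in ring) zero_notin_Units:
  assumes "\<one> \<noteq> \<zero>"
  shows "\<zero> \<notin> Units R"
  using assms by (auto simp: Units_def)

context ring_hom_ring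
begin

lemma kernel_disjoint_vimage_Units:
  assumes "\<one>\<^bsub>S\<^esub> \<noteq> \<zero>\<^bsub>S\<^esub>"
  shows "a_kernel R S h \<inter> {x \<in> carrier R. h x \<in> Units S} = {}"
  using S.zero_notin_Units[OF assms] unfolding a_kernel_def' by auto

lemma one_in_vimage_Units: "\<one> \<in> {x \<in> carrier R. h x \<in> Units S}"
  by simp

lemma mult_in_vimage_Units:
  assumes "x \<in> {x \<in> carrier R. h x \<in> Units S}" "y \<in> {x \<in> carrier R. h x \<in> Units S}"
  shows "x \<otimes> y \<in> {x \<in> carrier R. h x \<in> Units S}"
  using assms by simp

end

text \<open>
  All that is used about a pair of \<open>Hom R\<close>; the morphism itself is forgotten from here on.
\<close>

lemma HomE:
  fixes R :: "('a, 'm) ring_scheme" (structure)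
  assumes "ring R" and "(I, M) \<in> Hom R"
  obtains "ideal I R" "I \<inter> M = {}" "M \<subseteq> carrier R" "\<one> \<in> M"
    "\<And>x y. x \<in> M \<Longrightarrow> y \<in> M \<Longrightarrow> x \<otimes> y \<in> M"
proof -
  obtain S :: "('a + nat) ring" and \<phi> where S: "ring S" "\<one>\<^bsub>S\<^esub> \<noteq> \<zero>\<^bsub>S\<^esub>" "\<phi> \<in> ring_hom R S"
    and I: "I = a_kernel R S \<phi>" and M: "M = {x \<in> carrier R. \<phi> x \<in> Units S}"
    using assms(2) unfolding Hom_def by blast
  have hom: "ring_hom_ring R S \<phi>" by (rule ring_hom_ringI2[OF assms(1) S(1,3)])
  have "ideal I R" unfolding I by (rule ring_hom_ring.kernel_is_ideal[OF hom])
  moreover have "I \<inter> M = {}"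
    unfolding I M by (rule ring_hom_ring.kernel_disjoint_vimage_Units[OF hom S(2)])
  moreover have "M \<subseteq> carrier R" unfolding M by blast
  moreover have "\<one> \<in> M"
    unfolding M by (rule ring_hom_ring.one_in_vimage_Units[OF hom])
  moreover have "x \<otimes> y \<in> M" if "x \<in> M" "y \<in> M" for x y
    using that unfolding M by (rule ring_hom_ring.mult_in_vimage_Units[OF hom])
  ultimately show thesis by (rule that)
qed

text \<open>
  In a field every nonzero element is a unit, so for the composite of \<open>R \<rightarrow> R/P\<close> with the embedding
  of \<open>R/P\<close> into its field of fractions the preimage of the units is the complement of the kernel \<open>P\<close>.
\<close>

lemma primeideal_pair_in_Hom:
  assumes P: "primeideal P R"
  shows "(P, carrier R - P) \<in> Hom R"
proof -
  interpret primeideal P R by (rule P)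
  let ?D = "R Quot P"
  interpret D: domain ?D by (rule quotient_is_domain)
  let ?K = "fraction_ring ?D"
  interpret K: cring ?K by (rule D.fraction_ring_is_cring)
  let ?\<phi> = "(\<lambda>a. fraction ?D a \<one>\<^bsub>?D\<^esub>) \<circ> (+>\<^bsub>R\<^esub>) P"
  have hom: "?\<phi> \<in> ring_hom R ?K"
    using rcos_ring_hom D.fraction_one_hom by (rule ring_hom_trans)
  have closed: "P +>\<^bsub>R\<^esub> x \<in> carrier ?D" if "x \<in> carrier R" for x
    using rcos_ring_hom that by (rule ring_hom_closed)
  have zero: "P +>\<^bsub>R\<^esub> x = \<zero>\<^bsub>?D\<^esub> \<longleftrightarrow> x \<in> P" if "x \<in> carrier R" for x
    using that rcos_const_imp_mem a_rcos_const by (auto simp: FactRing_def)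
  have ker: "?\<phi> x = \<zero>\<^bsub>?K\<^esub> \<longleftrightarrow> x \<in> P" if "x \<in> carrier R" for x
    using that by (simp add: D.fraction_one_eq_zero_iff closed zero)
  have "a_kernel R ?K ?\<phi> = P"
    unfolding a_kernel_def' using ker a_subset by blast
  moreover have "?\<phi> x \<in> Units ?K \<longleftrightarrow> x \<notin> P" if "x \<in> carrier R" for x
    using that ker[OF that] K.zero_notin_Units[OF D.one_neq_zero_fraction_ring]
      D.fraction_one_in_Units[OF closed[OF that]] zero[OF that] by auto
  then have "{x \<in> carrier R. ?\<phi> x \<in> Units ?K} = carrier R - P" by blast
  ultimately show ?thesis
    using mem_HomI[OF ring_axioms K.ring_axioms D.one_neq_zero_fraction_ring hom] by simp
qed

theorem proposition5p3:
  fixes R :: "('a, 'm) ring_scheme" (structure)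
  assumes "cring R" and "\<one> \<noteq> \<zero>"
  shows "{x \<in> Hom R. \<forall>y \<in> Hom R. x \<le> y \<longrightarrow> y = x} = {(P, carrier R - P) | P. primeideal P R}"
proof (intro subset_antisym subsetI)
  interpret cring R by (rule assms)
  fix x assume "x \<in> {x \<in> Hom R. \<forall>y \<in> Hom R. x \<le> y \<longrightarrow> y = x}"
  then obtain I M where x: "x = (I, M)" "(I, M) \<in> Hom R"
    and max: "\<And>y. y \<in> Hom R \<Longrightarrow> (I, M) \<le> y \<Longrightarrow> y = (I, M)" by (cases x) auto
  obtain P where P: "primeideal P R" "I \<subseteq> P" "P \<inter> M = {}" "M \<subseteq> carrier R"
    using HomE[OF ring_axioms x(2)] exists_primeideal_avoiding by metis
  then have "(I, M) \<le> (P, carrier R - P)" by auto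
  then show "x \<in> {(P, carrier R - P) | P. primeideal P R}"
    using max[OF primeideal_pair_in_Hom[OF P(1)]] P(1) x(1) by auto
next
  interpret cring R by (rule assms)
  fix x assume "x \<in> {(P, carrier R - P) | P. primeideal P R}"
  then obtain P where P: "primeideal P R" and x: "x = (P, carrier R - P)" by blast
  have "y = x" if y: "y \<in> Hom R" "x \<le> y" for y
  proof -
    obtain J N where JN: "y = (J, N)" by (cases y)
    have "ideal J R" "J \<inter> N = {}" "N \<subseteq> carrier R"
      using HomE[OF ring_axioms, of J N] y(1) JN by metis+
    moreover have "P \<subseteq> J" "carrier R - P \<subseteq> N" using y(2) by (simp_all add: x JN)
    ultimately have "J = P" "N = carrier R - P" by (blast dest: ideal.Icarr)+
    then show ?thesis by (simp add: x JN)
  qed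
  then show "x \<in> {x \<in> Hom R. \<forall>y \<in> Hom R. x \<le> y \<longrightarrow> y = x}"
    using primeideal_pair_in_Hom[OF P] x by blast
qed

end
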